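(* Let $A\in\mathbb{C}^{4\times4}$. Any tangent of the inner conic of $A$ that passes through one of the eigenvalues of $A$ is also tangent to the Kippenhahn curve of $A$.
   Context: For an oriented line with unit direction $(\cos\theta,\sin\theta)$ through a point $x+iy$, its tangential angle is $\theta$ and its pedal coordinate with respect to the origin is $p:=x\sin\theta-y\cos\theta$. For $a\in\mathbb{C}$, $p(a):=p+\cos\theta\,\operatorname{Im}a-\sin\theta\,\operatorname{Re}a$ (so the line passes through $a$ iff $p(a)=0$); for a matrix $A$, $p(A):=pI+\cos\theta\,\operatorname{Im}A-\sin\theta\,\operatorname{Re}A$ with $\operatorname{Re}A=\frac{A+A^\star}{2}$, $\operatorname{Im}A=\frac{A-A^\star}{2i}$. A line is tangent to the Kippenhahn curve of $A$ when its $(p,\theta)$ satisfies $\det(p(A))=0$. Let $\lambda_1,\dots,\lambda_4$ be the eigenvalues of $A$. The matrix $\bar A$ (not the entrywise conjugate) denotes any matrix satisfying: $\bar AA=A\bar A$; $\overline{Q^{-1}AQ}=Q^{-1}\bar AQ$ for all invertible $Q$; $Au=\lambda u$ implies $\bar Au=\bar\lambda u$. $t_k(A):=\operatorname{tr}\big(A^k(A^\star-\bar A)\big)=\operatorname{tr}(A^kA^\star)-\sum_j\lambda_j^k\bar\lambda_j$; $e_2(M)$ is the second elementary symmetric polynomial of the eigenvalues of $M$. Let $\chi_\pm$ be the solutions of $t_1(A)x^2-(t_1(A)\operatorname{tr}(A)-t_2(A))x-\det(A)t_{-1}(A)=0$ and $\gamma_2:=\det(A)\big(e_2(A^{-1}A^\star)-e_2(A^{-1}\bar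 A)\big)+t_1(A)(\chi_+\overline{\chi_-}+\overline{\chi_+}\chi_-)$. For singular $A$ the products containing inverses are read through their polynomial form: $\det(A)\,t_{-1}(A)=\operatorname{tr}\big(\operatorname{adj}(A)(A^\star-\bar A)\big)$, and $\det(A)\,e_2(A^{-1}M)$ is the coefficient of $s^2$ in $\det(A+sM)$. The inner conic of $A$ is the singular solution (envelope of the lines) of $t_1(A)\,p(\chi_+)\,p(\chi_-)=\frac{\gamma_2}{4}$; its tangents are lines whose $(p,\theta)$ satisfy this equation. *)

theory Defs
  imports Complex_Main
    "Jordan_Normal_Form.Char_Poly"
    "Jordan_Normal_Form.Gauss_Jordan_Elimination"
    "Jordan_Normal_Form.Schur_Decomposition"
begin

section \<open>Matrices\<close>

definition mat_trace :: "complex mat \<Rightarrow> complex" where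
  "mat_trace M = (\<Sum>i<dim_row M. M $$ (i, i))"

text \<open>Only meaningful for invertible matrices.\<close>

definition mat_inv :: "complex mat \<Rightarrow> complex mat" where
  "mat_inv M = the (mat_inverse M)"

definition mat_zpow :: "complex mat \<Rightarrow> int \<Rightarrow> complex mat" where
  "mat_zpow M k = (if k \<ge> 0 then M ^\<^sub>m nat k else mat_inv M ^\<^sub>m nat (- k))"

definition Re_mat :: "complex mat \<Rightarrow> complex mat" where
  "Re_mat A = (1 / 2) \<cdot>\<^sub>m (A + mat_adjoint A)"

definition Im_mat :: "complex mat \<Rightarrow> complex mat" where
  "Im_mat A = (1 / (2 * \<i>)) \<cdot>\<^sub>m (A - mat_adjoint A)"

text \<open>The eigenvalues of \<open>M\<close>, repeated according to algebraic multiplicity, in some order.\<close>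

definition eigenvalue_list :: "complex mat \<Rightarrow> complex list" where
  "eigenvalue_list M = (SOME es. char_poly M = (\<Prod>e\<leftarrow>es. [:- e, 1:]))"

definition e2 :: "complex mat \<Rightarrow> complex" where
  "e2 M = (let es = eigenvalue_list M in \<Sum>j<length es. \<Sum>i<j. es ! i * es ! j)"

section \<open>Oriented lines\<close>

definition oriented_line :: "complex \<Rightarrow> real \<Rightarrow> complex set" where
  "oriented_line z \<theta> = {z + of_real s * cis \<theta> | s. True}"

definition pedal :: "complex \<Rightarrow> real \<Rightarrow> real" where
  "pedal z \<theta> = Re z * sin \<theta> - Im z * cos \<theta>"

text \<open>\<open>p(a)\<close> for a point \<open>a\<close> and \<open>p(A)\<close> for a matrix \<open>A\<close>.\<close>

definition pedal_at :: "real \<Rightarrow> real \<Rightarrow> complex \<Rightarrow> real" where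
  "pedal_at p \<theta> a = p + cos \<theta> * Im a - sin \<theta> * Re a"

definition pedal_mat :: "real \<Rightarrow> real \<Rightarrow> complex mat \<Rightarrow> complex mat" where
  "pedal_mat p \<theta> A =
     complex_of_real p \<cdot>\<^sub>m 1\<^sub>m (dim_row A)
       + complex_of_real (cos \<theta>) \<cdot>\<^sub>m Im_mat A - complex_of_real (sin \<theta>) \<cdot>\<^sub>m Re_mat A"

lemma in_oriented_line_iff: "a \<in> oriented_line z \<theta> \<longleftrightarrow> pedal_at (pedal z \<theta>) \<theta> a = 0"
proof
  assume "a \<in> oriented_line z \<theta>"
  then show "pedal_at (pedal z \<theta>) \<theta> a = 0"
    by (auto simp: oriented_line_def pedal_def pedal_at_def algebra_simps)
next
  assume h: "pedal_at (pedal z \<theta>) \<theta> a = 0"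
  define x y where "x = Re a - Re z" and "y = Im a - Im z"
  define s where "s = x * cos \<theta> + y * sin \<theta>"
  have eq: "cos \<theta> * y = sin \<theta> * x"
    using h by (simp add: pedal_at_def pedal_def x_def y_def algebra_simps)
  have "s * cos \<theta> = x * (cos \<theta>)\<^sup>2 + sin \<theta> * (cos \<theta> * y)"
    by (simp add: s_def power2_eq_square algebra_simps)
  also have "\<dots> = x * ((cos \<theta>)\<^sup>2 + (sin \<theta>)\<^sup>2)"
    unfolding eq by (simp only: power2_eq_square distrib_left ac_simps)
  finally have 1: "s * cos \<theta> = x" by simp
  have "s * sin \<theta> = cos \<theta> * (sin \<theta> * x) + y * (sin \<theta>)\<^sup>2"
    by (simp add: s_def power2_eq_square algebra_simps)
  also have "\<dots> = y * ((cos \<theta>)\<^sup>2 + (sin \<theta>)\<^sup>2)"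
    unfolding eq[symmetric] by (simp only: power2_eq_square distrib_left ac_simps)
  finally have 2: "s * sin \<theta> = y" by simp
  have "a = z + of_real s * cis \<theta>"
    using 1 2 by (simp add: complex_eq_iff x_def y_def)
  then show "a \<in> oriented_line z \<theta>" by (auto simp: oriented_line_def)
qed

definition kippenhahn_tangent :: "complex mat \<Rightarrow> real \<Rightarrow> real \<Rightarrow> bool" where
  "kippenhahn_tangent A p \<theta> \<longleftrightarrow> det (pedal_mat p \<theta> A) = 0"

section \<open>The matrix with conjugated eigenvalues\<close>

text \<open>
  \<open>bar A\<close> is neither the entrywise conjugate nor the adjoint. The three properties
  below are all that is required of it; they do not determine it uniquely when \<open>A\<close> is not
  diagonalizable. The second one needs the value of \<open>bar\<close> on every matrix similar to \<open>A\<close>.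
\<close>

definition eigen_conjugation :: "complex mat \<Rightarrow> (complex mat \<Rightarrow> complex mat) \<Rightarrow> bool" where
  "eigen_conjugation A bar \<longleftrightarrow> (let n = dim_row A in
     bar A \<in> carrier_mat n n \<and>
     bar A * A = A * bar A \<and>
     (\<forall>Q \<in> carrier_mat n n. invertible_mat Q \<longrightarrow>
        bar (mat_inv Q * A * Q) = mat_inv Q * bar A * Q) \<and>
     (\<forall>u \<in> carrier_vec n. \<forall>l. A *\<^sub>v u = l \<cdot>\<^sub>v u \<longrightarrow> bar A *\<^sub>v u = cnj l \<cdot>\<^sub>v u))"

text \<open>
  Such a \<open>bar\<close> exists: evaluate at \<open>A\<close> a polynomial that takes the value \<open>cnj l\<close> at every
  eigenvalue \<open>l\<close> of \<open>A\<close> and depends only on the characteristic polynomial of \<open>A\<close>.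
\<close>

definition mat_poly :: "complex list \<Rightarrow> complex mat \<Rightarrow> complex mat" where
  "mat_poly cs A = foldr (\<lambda>c M. c \<cdot>\<^sub>m 1\<^sub>m (dim_row A) + A * M) cs (0\<^sub>m (dim_row A) (dim_row A))"

lemma mat_poly_carrier:
  assumes A: "A \<in> carrier_mat n n"
  shows "mat_poly cs A \<in> carrier_mat n n"
proof -
  have "dim_row A = n" using A by simp
  then show ?thesis using A unfolding mat_poly_def by (induction cs) auto
qed

lemma mat_poly_simps:
  assumes A: "A \<in> carrier_mat n n"
  shows "mat_poly [] A = 0\<^sub>m n n"
    and "mat_poly (c # cs) A = c \<cdot>\<^sub>m 1\<^sub>m n + A * mat_poly cs A"
  using A by (auto simp: mat_poly_def)

lemma mat_poly_commute:
  assumes A: "A \<in> carrier_mat n n"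
  shows "mat_poly cs A * A = A * mat_poly cs A"
proof (induction cs)
  case Nil
  then show ?case using A by (simp add: mat_poly_simps[OF A])
next
  case (Cons c cs)
  let ?H = "mat_poly cs A"
  have H: "?H \<in> carrier_mat n n" by (rule mat_poly_carrier[OF A])
  have "(c \<cdot>\<^sub>m 1\<^sub>m n + A * ?H) * A = (c \<cdot>\<^sub>m 1\<^sub>m n) * A + A * ?H * A"
    using A H by (intro add_mult_distrib_mat[where nr = n and n = n and nc = n]) auto
  also have "(c \<cdot>\<^sub>m 1\<^sub>m n) * A = A * (c \<cdot>\<^sub>m 1\<^sub>m n)"
    using A by (simp add: mult_smult_distrib[where nr = n and n = n and nc = n]
        mult_smult_assoc_mat[where nr = n and n = n and nc = n])
  also have "A * ?H * A = A * (A * ?H)"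
    using A H Cons by simp
  also have "A * (c \<cdot>\<^sub>m 1\<^sub>m n) + A * (A * ?H) = A * (c \<cdot>\<^sub>m 1\<^sub>m n + A * ?H)"
    using A H by (intro mult_add_distrib_mat[symmetric, where nr = n and n = n and nc = n]) auto
  finally show ?case by (simp add: mat_poly_simps[OF A])
qed

lemma mat_poly_similar:
  assumes A: "A \<in> carrier_mat n n" and Q: "Q \<in> carrier_mat n n" and R: "R \<in> carrier_mat n n"
    and QR: "Q * R = 1\<^sub>m n" and RQ: "R * Q = 1\<^sub>m n"
  shows "mat_poly cs (R * A * Q) = R * mat_poly cs A * Q"
proof (induction cs)
  case Nil
  have "R * A * Q \<in> carrier_mat n n" using A Q R by simp
  then show ?case using A Q R by (simp add: mat_poly_simps)
next
  case (Cons c cs)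
  let ?H = "mat_poly cs A"
  have H: "?H \<in> carrier_mat n n" by (rule mat_poly_carrier[OF A])
  have RAQ: "R * A * Q \<in> carrier_mat n n" using A Q R by simp
  have "R * A * Q * (R * ?H * Q) = R * A * (Q * (R * (?H * Q)))"
    using A Q R H by (simp add: assoc_mult_mat[where ?n\<^sub>1.0 = n and ?n\<^sub>2.0 = n and ?n\<^sub>3.0 = n and ?n\<^sub>4.0 = n])
  also have "Q * (R * (?H * Q)) = (Q * R) * (?H * Q)"
    using Q R H by (intro assoc_mult_mat[symmetric, where ?n\<^sub>1.0 = n and ?n\<^sub>2.0 = n and ?n\<^sub>3.0 = n and ?n\<^sub>4.0 = n]) auto
  also have "R * A * ((Q * R) * (?H * Q)) = R * (A * ?H) * Q"
    using A Q R H QR by (simp add: assoc_mult_mat[where ?n\<^sub>1.0 = n and ?n\<^sub>2.0 = n and ?n\<^sub>3.0 = n and ?n\<^sub>4.0 = n])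
  finally have 1: "R * A * Q * (R * ?H * Q) = R * (A * ?H) * Q" .
  have "R * (c \<cdot>\<^sub>m 1\<^sub>m n) * Q = c \<cdot>\<^sub>m (R * Q)"
    using Q R by (simp add: mult_smult_distrib[where nr = n and n = n and nc = n]
        mult_smult_assoc_mat[where nr = n and n = n and nc = n])
  then have 2: "c \<cdot>\<^sub>m 1\<^sub>m n = R * (c \<cdot>\<^sub>m 1\<^sub>m n) * Q" using RQ by simp
  have "R * (c \<cdot>\<^sub>m 1\<^sub>m n + A * ?H) * Q = (R * (c \<cdot>\<^sub>m 1\<^sub>m n) + R * (A * ?H)) * Q"
    using A R H by (subst mult_add_distrib_mat[where nr = n and n = n and nc = n]) auto
  also have "\<dots> = R * (c \<cdot>\<^sub>m 1\<^sub>m n) * Q + R * (A * ?H) * Q"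
    using A R Q H by (intro add_mult_distrib_mat[where nr = n and n = n and nc = n]) auto
  also have "\<dots> = c \<cdot>\<^sub>m 1\<^sub>m n + R * A * Q * (R * ?H * Q)"
    unfolding 1 using 2 by simp
  finally show ?case
    using Cons by (simp add: mat_poly_simps[OF A] mat_poly_simps[OF RAQ])
qed

lemma mat_poly_eigenvector:
  assumes A: "A \<in> carrier_mat n n" and u: "u \<in> carrier_vec n" and Au: "A *\<^sub>v u = l \<cdot>\<^sub>v u"
  shows "mat_poly cs A *\<^sub>v u = poly (Poly cs) l \<cdot>\<^sub>v u"
proof (induction cs)
  case Nil
  then show ?case using u by (auto simp: mat_poly_simps[OF A])
next
  case (Cons c cs)
  let ?H = "mat_poly cs A"
  have H: "?H \<in> carrier_mat n n" by (rule mat_poly_carrier[OF A])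
  have "(c \<cdot>\<^sub>m 1\<^sub>m n + A * ?H) *\<^sub>v u = (c \<cdot>\<^sub>m 1\<^sub>m n) *\<^sub>v u + A *\<^sub>v (?H *\<^sub>v u)"
    using A H u by (simp add: add_mult_distrib_mat_vec[where nr = n and nc = n]
      assoc_mult_mat_vec[where ?n\<^sub>1.0 = n and ?n\<^sub>2.0 = n and ?n\<^sub>3.0 = n])
  also have "(c \<cdot>\<^sub>m 1\<^sub>m n) *\<^sub>v u = c \<cdot>\<^sub>v u"
    using u by (intro eq_vecI) auto
  also have "A *\<^sub>v (?H *\<^sub>v u) = poly (Poly cs) l \<cdot>\<^sub>v (l \<cdot>\<^sub>v u)"
    using A u by (simp add: Cons mult_mat_vec[OF A u] Au)
  also have "c \<cdot>\<^sub>v u + poly (Poly cs) l \<cdot>\<^sub>v (l \<cdot>\<^sub>v u) = poly (Poly (c # cs)) l \<cdot>\<^sub>v u"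
    using u by (auto simp: vec_eq_iff algebra_simps)
  finally show ?case by (simp add: mat_poly_simps[OF A])
qed

lemma ex_poly_cnj:
  assumes "finite S"
  shows "\<exists>f. \<forall>l\<in>S. poly f l = cnj l"
  using assms
proof (induction S)
  case empty
  then show ?case by simp
next
  case (insert a S)
  then obtain f where f: "\<forall>l\<in>S. poly f l = cnj l" by blast
  define w where "w = (\<Prod>l\<in>S. [:- l, 1:])"
  have wS: "poly w l = 0" if "l \<in> S" for l
    using that insert.hyps by (auto simp: w_def poly_prod)
  have wa: "poly w a \<noteq> 0"
    using insert.hyps by (auto simp: w_def poly_prod)
  have "\<forall>l\<in>insert a S. poly (f + smult ((cnj a - poly f a) / poly w a) w) l = cnj l"
    using f wS wa by auto
  then show ?case by blast
qed

lemma mat_inv: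
  assumes Q: "Q \<in> carrier_mat n n" and inv: "invertible_mat Q"
  shows "mat_inv Q \<in> carrier_mat n n" "Q * mat_inv Q = 1\<^sub>m n" "mat_inv Q * Q = 1\<^sub>m n"
proof -
  obtain B where B: "inverts_mat Q B" "inverts_mat B Q"
    using inv by (auto simp: invertible_mat_def)
  have 1: "Q * B = 1\<^sub>m n" using B Q by (simp add: inverts_mat_def)
  have 2: "B * Q = 1\<^sub>m (dim_row B)" using B by (simp add: inverts_mat_def)
  have "dim_col B = n" using arg_cong[OF 1, of dim_col] by simp
  moreover have "dim_row B = n" using arg_cong[OF 2, of dim_col] Q by simp
  ultimately have BC: "B \<in> carrier_mat n n" by auto
  have "Q \<in> Units (ring_mat TYPE(complex) n n)"
    using Q BC 1 2 by (auto simp: Units_def ring_mat_def intro!: bexI[of _ B])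
  then obtain C where C: "mat_inverse Q = Some C"
    using mat_inverse(1)[OF Q, where b = n] by (cases "mat_inverse Q") auto
  from mat_inverse(2)[OF Q C] C
  show "mat_inv Q \<in> carrier_mat n n" "Q * mat_inv Q = 1\<^sub>m n" "mat_inv Q * Q = 1\<^sub>m n"
    by (auto simp: mat_inv_def)
qed

lemma ex_eigen_conjugation:
  "\<exists>bar. \<forall>A. square_mat A \<longrightarrow> eigen_conjugation A bar"
proof -
  define f where "f c = (SOME f. \<forall>l. poly c l = 0 \<longrightarrow> poly f l = cnj l)" for c :: "complex poly"
  define bar where "bar A = mat_poly (coeffs (f (char_poly A))) A" for A
  have "eigen_conjugation A bar" if "square_mat A" for A
  proof -
    define n where "n = dim_row A"
    have A: "A \<in> carrier_mat n n" using that by (auto simp: n_def)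
    have "char_poly A \<noteq> 0" using degree_monic_char_poly[OF A] by auto
    then have "finite {l. poly (char_poly A) l = 0}" by (rule poly_roots_finite)
    from ex_poly_cnj[OF this]
    have "\<exists>g. \<forall>l. poly (char_poly A) l = 0 \<longrightarrow> poly g l = cnj l" by simp
    then have f: "\<forall>l. poly (char_poly A) l = 0 \<longrightarrow> poly (f (char_poly A)) l = cnj l"
      unfolding f_def by (rule someI_ex)
    have "bar (mat_inv Q * A * Q) = mat_inv Q * bar A * Q"
      if Q: "Q \<in> carrier_mat n n" and "invertible_mat Q" for Q
    proof -
      note R = mat_inv[OF that]
      have "similar_mat (mat_inv Q * A * Q) A"
        unfolding similar_mat_def similar_mat_wit_def
        using A Q R by (intro exI[of _ "mat_inv Q"] exI[of _ Q]) (auto simp: Let_def)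
      then have "char_poly (mat_inv Q * A * Q) = char_poly A"
        by (rule char_poly_similar)
      then show ?thesis
        using mat_poly_similar[OF A Q R] by (simp add: bar_def)
    qed
    moreover have "bar A *\<^sub>v u = cnj l \<cdot>\<^sub>v u"
      if u: "u \<in> carrier_vec n" and Au: "A *\<^sub>v u = l \<cdot>\<^sub>v u" for u l
    proof (cases "u = 0\<^sub>v n")
      case True
      then show ?thesis
        using mat_poly_carrier[OF A, of "coeffs (f (char_poly A))"]
        by (intro eq_vecI) (auto simp: bar_def)
    next
      case False
      then have "eigenvalue A l"
        using A u Au by (auto simp: eigenvalue_def eigenvector_def)
      then have "poly (f (char_poly A)) l = cnj l"
        using f eigenvalue_root_char_poly[OF A] by simp
      then show ?thesis
        using mat_poly_eigenvector[OF A u Au] by (simp add: bar_def)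
    qed
    ultimately show ?thesis
      using mat_poly_carrier[OF A] mat_poly_commute[OF A]
      by (auto simp: eigen_conjugation_def Let_def bar_def n_def[symmetric])
  qed
  then show ?thesis by blast
qed

section \<open>The inner conic of a \<open>4 \<times> 4\<close> matrix\<close>

text \<open>In this section \<open>B\<close> stands for \<open>bar A\<close>.\<close>

definition t_coeff :: "int \<Rightarrow> complex mat \<Rightarrow> complex mat \<Rightarrow> complex" where
  "t_coeff k A B = mat_trace (mat_zpow A k * (mat_adjoint A - B))"

text \<open>\<open>det(A) t\<^sub>-\<^sub>1(A)\<close> and \<open>det(A) e\<^sub>2(A\<^sup>-\<^sup>1 M)\<close>, continued polynomially to singular \<open>A\<close>.\<close>

definition det_t_minus1 :: "complex mat \<Rightarrow> complex mat \<Rightarrow> complex" where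
  "det_t_minus1 A B =
     (if invertible_mat A then det A * t_coeff (-1) A B
      else mat_trace (adj_mat A * (mat_adjoint A - B)))"

definition det_e2 :: "complex mat \<Rightarrow> complex mat \<Rightarrow> complex" where
  "det_e2 A M =
     (if invertible_mat A then det A * e2 (mat_inv A * M)
      else coeff (det (map_mat (\<lambda>a. [:a:]) A + map_mat (\<lambda>m. [:0, m:]) M)) 2)"

text \<open>
  \<open>x\<^sub>1\<close> and \<open>x\<^sub>2\<close> are the two solutions, with multiplicity, of the quadratic equation on the
  left. For normal \<open>A\<close> all its coefficients vanish, and \<open>x\<^sub>1\<close>, \<open>x\<^sub>2\<close> are then arbitrary.
\<close>

definition chi_pair :: "complex mat \<Rightarrow> complex mat \<Rightarrow> complex \<Rightarrow> complex \<Rightarrow> bool" where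
  "chi_pair A B x\<^sub>1 x\<^sub>2 \<longleftrightarrow> (\<forall>x.
     t_coeff 1 A B * x\<^sup>2 - (t_coeff 1 A B * mat_trace A - t_coeff 2 A B) * x - det_t_minus1 A B
       = t_coeff 1 A B * (x - x\<^sub>1) * (x - x\<^sub>2))"

definition gamma2 :: "complex mat \<Rightarrow> complex mat \<Rightarrow> complex \<Rightarrow> complex \<Rightarrow> complex" where
  "gamma2 A B x\<^sub>1 x\<^sub>2 = det_e2 A (mat_adjoint A) - det_e2 A B
     + t_coeff 1 A B * (x\<^sub>1 * cnj x\<^sub>2 + cnj x\<^sub>1 * x\<^sub>2)"

definition inner_conic_tangent ::
  "complex mat \<Rightarrow> complex mat \<Rightarrow> complex \<Rightarrow> complex \<Rightarrow> real \<Rightarrow> real \<Rightarrow> bool" where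
  "inner_conic_tangent A B x\<^sub>1 x\<^sub>2 p \<theta> \<longleftrightarrow>
     t_coeff 1 A B * of_real (pedal_at p \<theta> x\<^sub>1) * of_real (pedal_at p \<theta> x\<^sub>2) = gamma2 A B x\<^sub>1 x\<^sub>2 / 4"

end

theory Submission
  imports Defs
begin

text \<open>
  Put \<open>F(p, s, t) = det (p I + s A + t A\<^sup>*)\<close> and \<open>G(p, s, t) = det (p I + s A + t B)\<close>, where
  \<open>B\<close> is the matrix \<open>bar A\<close>. Since \<open>A\<close> and \<open>B\<close> are simultaneously
  triangularizable with conjugate diagonals, \<open>G\<close> is the product of the linear forms
  \<open>p + s \<lambda> + t cnj \<lambda>\<close> over the eigenvalues \<open>\<lambda>\<close> of \<open>A\<close>. The forms \<open>F\<close> and \<open>G\<close> agree for \<open>s = 0\<close> and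
  for \<open>t = 0\<close>, so \<open>F - G\<close> is \<open>s t\<close> times a quadratic form, and comparing coefficients this form is
  \<open>\<gamma>\<^sub>2 s t - t\<^sub>1 (p + s \<chi>\<^sub>1 + t cnj \<chi>\<^sub>1) (p + s \<chi>\<^sub>2 + t cnj \<chi>\<^sub>2)\<close>. For \<open>s = - \<i> exp (- \<i> \<theta>) / 2\<close> and
  \<open>t = cnj s\<close> one has \<open>s t = 1 / 4\<close>, \<open>F = det (p(A))\<close> and \<open>p + s a + t cnj a = p(a)\<close>. Hence \<open>F = G\<close> on the
  tangents of the inner conic, and \<open>G\<close> vanishes on the lines through an eigenvalue.
\<close>

section \<open>Determinants of \<open>4 \<times> 4\<close> pencils\<close>

lemma det_3:
  fixes A :: "'a :: comm_ring_1 mat"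
  assumes A: "A \<in> carrier_mat 3 3"
  shows "det A = A $$ (0,0) * (A $$ (1,1) * A $$ (2,2) - A $$ (1,2) * A $$ (2,1))
     - A $$ (0,1) * (A $$ (1,0) * A $$ (2,2) - A $$ (1,2) * A $$ (2,0))
     + A $$ (0,2) * (A $$ (1,0) * A $$ (2,1) - A $$ (1,1) * A $$ (2,0))"
proof -
  have d2: "det M = M $$ (0,0) * M $$ (1,1) - M $$ (0,1) * M $$ (1,0)"
    if M: "M \<in> carrier_mat 2 2" for M :: "'a mat"
    using M by (simp add: laplace_expansion_row[OF M, of 0] cofactor_def numeral_2_eq_2
        det_single mat_delete_def)
  show ?thesis
    using A by (simp add: laplace_expansion_row[OF A, of 0] cofactor_def eval_nat_numeral
        d2[unfolded numeral_2_eq_2] mat_delete_def algebra_simps)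
qed

lemma det_4:
  fixes A :: "'a :: comm_ring_1 mat"
  assumes A: "A \<in> carrier_mat 4 4"
  shows "det A = A $$ (0,0) * cofactor A 0 0 + A $$ (0,1) * cofactor A 0 1
     + A $$ (0,2) * cofactor A 0 2 + A $$ (0,3) * cofactor A 0 3"
  using A by (simp add: laplace_expansion_row[OF A, of 0] eval_nat_numeral)

lemma mat_trace_mult:
  "A \<in> carrier_mat n n \<Longrightarrow> B \<in> carrier_mat n n \<Longrightarrow>
    mat_trace (A * B) = (\<Sum>i<n. \<Sum>j<n. A $$ (i, j) * B $$ (j, i))"
  by (simp add: mat_trace_def scalar_prod_def atLeast0LessThan)

lemma sum_lessThan_4: "(\<Sum>i<4. f i) = f 0 + f 1 + f 2 + f (3::nat)"
  by (simp add: eval_nat_numeral)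

text \<open>The second elementary symmetric polynomial of the eigenvalues in terms of entries.
  Unlike \<open>e2\<close> it involves no choice of an eigenvalue list, so it can enter polynomial
  identities; \<open>e2_eq_minor_sum2\<close> links the two.\<close>

definition minor_sum2 :: "complex mat \<Rightarrow> complex" where
  "minor_sum2 A = (\<Sum>j<dim_row A. \<Sum>i<j. A $$ (i,i) * A $$ (j,j) - A $$ (i,j) * A $$ (j,i))"

text \<open>The coefficient of \<open>s\<^sup>2 t\<^sup>2\<close> in \<open>det (s A + t B)\<close>, isolated at \<open>s = t = 1\<close>.\<close>

definition mixed_det :: "complex mat \<Rightarrow> complex mat \<Rightarrow> complex" where
  "mixed_det A B = det (A + B) - det A - det B - mat_trace (adj_mat A * B) - mat_trace (adj_mat B * A)"

lemma minor_sum2_4: "A \<in> carrier_mat 4 4 \<Longrightarrow> minor_sum2 A =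
   A $$ (0,0) * A $$ (1,1) - A $$ (0,1) * A $$ (1,0)
 + A $$ (0,0) * A $$ (2,2) - A $$ (0,2) * A $$ (2,0)
 + A $$ (0,0) * A $$ (3,3) - A $$ (0,3) * A $$ (3,0)
 + A $$ (1,1) * A $$ (2,2) - A $$ (1,2) * A $$ (2,1)
 + A $$ (1,1) * A $$ (3,3) - A $$ (1,3) * A $$ (3,1)
 + A $$ (2,2) * A $$ (3,3) - A $$ (2,3) * A $$ (3,2)"
  by (simp add: minor_sum2_def eval_nat_numeral)

lemma mat_trace_4:
  "A \<in> carrier_mat 4 4 \<Longrightarrow> mat_trace A = A $$ (0,0) + A $$ (1,1) + A $$ (2,2) + A $$ (3,3)"
  by (simp add: mat_trace_def sum_lessThan_4)

text \<open>The coefficients are the elementary symmetric polynomials of the eigenvalues, as sums of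
  principal minors; the third is the trace of the adjugate.\<close>

lemma det_pencil_single:
  assumes A: "A \<in> carrier_mat 4 4"
  shows "det (p \<cdot>\<^sub>m 1\<^sub>m 4 + s \<cdot>\<^sub>m A) = p^4 + p^3 * s * mat_trace A + p^2 * s^2 * minor_sum2 A
    + p * s^3 * mat_trace (adj_mat A) + s^4 * det A"
proof -
  note dims = carrier_matD[OF A] carrier_matD[OF adj_mat(1)[OF A]]
  \<comment> \<open>The adjugate is first kept as an opaque matrix and only then expanded. Indices
    are brought back to numerals so that equal entries become equal atoms of the final ring
    identity.\<close>
  show ?thesis
    by (simp add: dims A adj_mat(1) det_4 cofactor_def mat_delete_def det_3 mat_trace_4 minor_sum2_4,
        simp add: dims adj_mat_def cofactor_def mat_delete_def det_3,
        simp only: One_nat_def[symmetric] Suc_1,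
        Groebner_Basis.algebra)
qed

text \<open>Monomials free of \<open>s\<close> or of \<open>t\<close> are collected in the two
  single pencils, where \<open>p^4\<close> is counted twice. Every other monomial is divisible by
  \<open>s * t\<close>, which leaves a ternary quadratic form in \<open>p\<close>, \<open>s\<close>,
  \<open>t\<close>.\<close>

lemma det_pencil:
  assumes A: "A \<in> carrier_mat 4 4" and B: "B \<in> carrier_mat 4 4"
  shows "det (p \<cdot>\<^sub>m 1\<^sub>m 4 + s \<cdot>\<^sub>m A + t \<cdot>\<^sub>m B) =
    det (p \<cdot>\<^sub>m 1\<^sub>m 4 + s \<cdot>\<^sub>m A) + det (p \<cdot>\<^sub>m 1\<^sub>m 4 + t \<cdot>\<^sub>m B) - p^4
    + s * t * ((mat_trace A * mat_trace B - mat_trace (A * B)) * p^2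
      + (mat_trace (A * A * B) - mat_trace A * mat_trace (A * B) + minor_sum2 A * mat_trace B) * p * s
      + (mat_trace (B * B * A) - mat_trace B * mat_trace (A * B) + minor_sum2 B * mat_trace A) * p * t
      + mat_trace (adj_mat A * B) * s^2 + mixed_det A B * s * t + mat_trace (adj_mat B * A) * t^2)"
proof -
  note adj = adj_mat(1)[OF A] adj_mat(1)[OF B]
  have carrier: "A * B \<in> carrier_mat 4 4" "A * A * B \<in> carrier_mat 4 4" "B * B * A \<in> carrier_mat 4 4"
    "adj_mat A * B \<in> carrier_mat 4 4" "adj_mat B * A \<in> carrier_mat 4 4"
    using A B adj by auto
  note dims = carrier_matD[OF A] carrier_matD[OF B] carrier_matD[OF adj(1)] carrier_matD[OF adj(2)]
  show ?thesis
    by (simp add: dims A B adj carrier det_4 mixed_det_def cofactor_def mat_delete_def det_3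
          mat_trace_4 minor_sum2_4 scalar_prod_def sum_lessThan_4 atLeast0LessThan,
        simp add: dims adj_mat_def cofactor_def mat_delete_def det_3,
        simp only: One_nat_def[symmetric] Suc_1,
        Groebner_Basis.algebra)
qed

section \<open>Commuting matrices\<close>

lemma smult_mat_mult_vec:
  fixes c :: "'a :: comm_ring_1"
  assumes "A \<in> carrier_mat nr nc" "v \<in> carrier_vec nc"
  shows "(c \<cdot>\<^sub>m A) *\<^sub>v v = c \<cdot>\<^sub>v (A *\<^sub>v v)"
  using assms by (intro eq_vecI) (auto simp: scalar_prod_def sum_distrib_left mult.assoc)

lemma ex_schur:
  fixes A :: "complex mat"
  assumes A: "A \<in> carrier_mat n n"
  obtains U P Q where "similar_mat_wit A U P Q" "upper_triangular U"
proof -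
  obtain es where es: "char_poly A = (\<Prod>e\<leftarrow>es. [:- e, 1:])"
    using char_poly_factorized[OF A] by blast
  obtain U P Q where "schur_decomposition A es = (U, P, Q)"
    by (cases "schur_decomposition A es")
  from schur_decomposition[OF A es this] that show thesis by blast
qed

text \<open>
  Among the nonzero vectors of the kernel of \<open>M\<close>, take one whose coordinates in a Schur basis of \<open>N\<close>
  end as early as possible, at index \<open>k\<close>. Applying \<open>N - \<mu>\<close>, with \<open>\<mu>\<close> the \<open>k\<close>-th diagonal entry of the
  triangular form, stays in the kernel and shortens the vector, so the result is zero.
\<close>

lemma commuting_common_eigenvector:
  fixes M N :: "complex mat"
  assumes M: "M \<in> carrier_mat n n" and N: "N \<in> carrier_mat n n" and MN: "M * N = N * M"
    and det0: "det M = 0"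
  obtains u \<mu> where "u \<in> carrier_vec n" "u \<noteq> 0\<^sub>v n" "M *\<^sub>v u = 0\<^sub>v n" "N *\<^sub>v u = \<mu> \<cdot>\<^sub>v u"
proof -
  obtain U P Q where wit: "similar_mat_wit N U P Q" and ut: "upper_triangular U"
    using ex_schur[OF N] .
  note w = similar_mat_witD2[OF N wit]
  have U: "U \<in> carrier_mat n n" and P: "P \<in> carrier_mat n n" and Q: "Q \<in> carrier_mat n n"
    and PQ: "P * Q = 1\<^sub>m n" and QP: "Q * P = 1\<^sub>m n" and NU: "N = P * U * Q"
    using w by auto
  define K where "K v \<longleftrightarrow> v \<in> carrier_vec n \<and> v \<noteq> 0\<^sub>v n \<and> M *\<^sub>v v = 0\<^sub>v n" for v
  define L where "L v k \<longleftrightarrow> (\<forall>i. k \<le> i \<longrightarrow> i < n \<longrightarrow> (Q *\<^sub>v v) $ i = 0)" for v k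
  \<comment> \<open>For \<open>k = n\<close> the condition \<open>L\<close> is vacuous, so any
    nonzero kernel vector of \<open>M\<close> will do.\<close>
  have "\<exists>k v. K v \<and> L v k"
    using det0 unfolding det_0_iff_vec_prod_zero[OF M] K_def L_def
    by (meson le_antisym less_imp_le_nat not_less)
  then have ex: "\<exists>k. \<exists>v. K v \<and> L v k" .
  define k where "k = (LEAST k. \<exists>v. K v \<and> L v k)"
  have least: "\<nexists>v. K v \<and> L v k'" if "k' < k" for k'
    using not_less_Least that unfolding k_def by blast
  obtain v where Kv: "K v" and Lv: "L v k" using LeastI_ex[OF ex] unfolding k_def by blast
  have v: "v \<in> carrier_vec n" "v \<noteq> 0\<^sub>v n" "M *\<^sub>v v = 0\<^sub>v n" using Kv by (auto simp: K_def)
  define y where "y = Q *\<^sub>v v"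
  have y: "y \<in> carrier_vec n" using Q v by (simp add: y_def)
  have Py: "P *\<^sub>v y = v"
    using P Q v PQ by (simp add: y_def assoc_mult_mat_vec[symmetric, where ?n\<^sub>1.0 = n and ?n\<^sub>2.0 = n and ?n\<^sub>3.0 = n])
  have "k > 0"
  proof (rule ccontr)
    assume "\<not> k > 0"
    then have "y = 0\<^sub>v n" using Lv y Q by (intro eq_vecI) (auto simp: L_def y_def)
    then show False using Py v P by auto
  qed
  \<comment> \<open>For \<open>k > n\<close> no index \<open>i < n\<close> satisfies
    \<open>k - 1 \<le> i\<close>, so the value 0 is arbitrary; it spares a proof of
    \<open>k \<le> n\<close>.\<close>
  define \<mu> where "\<mu> = (if k \<le> n then U $$ (k - 1, k - 1) else 0)"
  define v' where "v' = N *\<^sub>v v - \<mu> \<cdot>\<^sub>v v"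
  have v': "v' \<in> carrier_vec n" using N v by (simp add: v'_def)
  have "M *\<^sub>v v' = 0\<^sub>v n"
  proof -
    have "M *\<^sub>v (N *\<^sub>v v) = N *\<^sub>v (M *\<^sub>v v)"
      using assoc_mult_mat_vec[OF M N v(1)] assoc_mult_mat_vec[OF N M v(1)] MN by simp
    then show ?thesis
      using M N v by (simp add: v'_def mult_minus_distrib_mat_vec[where nr = n and nc = n] mult_mat_vec)
        (intro eq_vecI, auto)
  qed
  moreover have "L v' (k - 1)"
  proof -
    have "Q * N = (Q * P) * (U * Q)"
      using assoc_mult_mat[OF P U Q] assoc_mult_mat[OF Q P mult_carrier_mat[OF U Q]] by (simp add: NU)
    then have "Q * N = U * Q" using QP U Q by simp
    then have "Q *\<^sub>v (N *\<^sub>v v) = U *\<^sub>v y"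
      using assoc_mult_mat_vec[OF Q N v(1)] assoc_mult_mat_vec[OF U Q v(1)] by (simp add: y_def)
    then have Qv': "Q *\<^sub>v v' = U *\<^sub>v y - \<mu> \<cdot>\<^sub>v y"
      using Q N v by (simp add: v'_def mult_minus_distrib_mat_vec[where nr = n and nc = n] mult_mat_vec y_def)
    show ?thesis unfolding L_def
    proof (intro allI impI)
      fix i assume i: "k - 1 \<le> i" "i < n"
      have "(U *\<^sub>v y) $ i = (\<Sum>j<n. U $$ (i, j) * y $ j)"
        using U y i by (simp add: scalar_prod_def atLeast0LessThan)
      \<comment> \<open>Terms with \<open>j < i\<close> vanish because \<open>U\<close> is
        triangular; for \<open>j > i\<close> one has \<open>j \<ge> k\<close>, where
        \<open>y\<close> is zero.\<close>
      also have "\<dots> = (\<Sum>j<n. if j = i then U $$ (i, i) * y $ i else 0)"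
      proof (rule sum.cong[OF refl])
        fix j assume j: "j \<in> {..<n}"
        consider "j < i" | "j = i" | "j > i" by linarith
        then show "U $$ (i, j) * y $ j = (if j = i then U $$ (i, i) * y $ i else 0)"
        proof cases
          case 1
          then show ?thesis using ut U i by auto
        next
          case 3
          then have "y $ j = 0" using Lv j i unfolding L_def y_def by auto
          then show ?thesis using 3 by simp
        qed simp
      qed
      also have "\<dots> = \<mu> * y $ i"
      proof (cases "i = k - 1")
        case True
        then show ?thesis using i \<open>k > 0\<close> by (simp add: \<mu>_def)
      next
        case False
        then have "y $ i = 0" using Lv i unfolding L_def y_def by auto
        then show ?thesis by simp
      qed
      finally show "(Q *\<^sub>v v') $ i = 0" unfolding Qv' using U y i by simp
    qed
  qed
  ultimately have "v' = 0\<^sub>v n"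
    using least[of "k - 1"] \<open>k > 0\<close> v' unfolding K_def by auto
  have "N *\<^sub>v v = \<mu> \<cdot>\<^sub>v v"
  proof (rule eq_vecI)
    fix i assume "i < dim_vec (\<mu> \<cdot>\<^sub>v v)"
    then show "(N *\<^sub>v v) $ i = (\<mu> \<cdot>\<^sub>v v) $ i"
      using arg_cong[OF \<open>v' = 0\<^sub>v n\<close>, of "\<lambda>w. w $ i"] N v(1) by (simp add: v'_def)
  qed (use N v(1) in simp)
  then show thesis using that v by blast
qed

text \<open>Makes the determinant along a line of matrices a polynomial, as the fundamental theorem
  of algebra requires. The same polynomial defines \<open>det_e2\<close> for singular
  matrices.\<close>

lemma det_add_smult_poly:
  fixes X N :: "complex mat"
  assumes X: "X \<in> carrier_mat n n" and N: "N \<in> carrier_mat n n"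
  shows "poly (det (map_mat (\<lambda>a. [:a:]) X + map_mat (\<lambda>m. [:0, m:]) N)) x = det (X + x \<cdot>\<^sub>m N)"
  by (rule poly_det_cong[where n = n]) (use X N in auto)

text \<open>
  As a polynomial in \<open>x\<close>, the determinant of \<open>X + x N\<close> vanishes identically as soon as it has a root,
  so it is constant.
\<close>

lemma det_add_smult_quasinilpotent:
  fixes X N :: "complex mat"
  assumes X: "X \<in> carrier_mat n n" and N: "N \<in> carrier_mat n n" and XN: "X * N = N * X"
    and nil: "\<And>l. eigenvalue N l \<Longrightarrow> l = 0"
  shows "det (X + x \<cdot>\<^sub>m N) = det X"
proof -
  \<comment> \<open>At a root the singular matrix commutes with \<open>N\<close>, so its kernel
    contains an eigenvector of \<open>N\<close>. The eigenvalue is 0, hence this vector is killed by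
    \<open>X + y \<cdot>\<^sub>m N\<close> for every \<open>y\<close>.\<close>
  have vanish: "det (X + y \<cdot>\<^sub>m N) = 0" if sing: "det (X + x \<cdot>\<^sub>m N) = 0" for x y
  proof -
    have XC: "X + x \<cdot>\<^sub>m N \<in> carrier_mat n n" using X N by simp
    have comm: "(X + x \<cdot>\<^sub>m N) * N = N * (X + x \<cdot>\<^sub>m N)"
      using X N XN by (simp add: add_mult_distrib_mat[where nr = n and n = n and nc = n]
          mult_add_distrib_mat[where nr = n and n = n and nc = n]
          mult_smult_distrib[where nr = n and n = n and nc = n]
          mult_smult_assoc_mat[where nr = n and n = n and nc = n])
    obtain u \<mu> where u: "u \<in> carrier_vec n" "u \<noteq> 0\<^sub>v n"
      "(X + x \<cdot>\<^sub>m N) *\<^sub>v u = 0\<^sub>v n" "N *\<^sub>v u = \<mu> \<cdot>\<^sub>v u"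
      using commuting_common_eigenvector[OF XC N comm sing] .
    have "eigenvalue N \<mu>" using u N by (auto simp: eigenvalue_def eigenvector_def)
    then have "N *\<^sub>v u = 0\<^sub>v n" using nil u by auto
    moreover have "c \<cdot>\<^sub>v 0\<^sub>v n = (0\<^sub>v n :: complex vec)" for c by (intro eq_vecI) auto
    ultimately have shift: "(X + c \<cdot>\<^sub>m N) *\<^sub>v u = X *\<^sub>v u" for c
      using u X N by (simp add: add_mult_distrib_mat_vec[where nr = n and nc = n]
          smult_mat_mult_vec[of _ n n])
    have "(X + y \<cdot>\<^sub>m N) *\<^sub>v u = 0\<^sub>v n" using u(3) by (simp add: shift)
    then show ?thesis
      using u det_0_iff_vec_prod_zero[of "X + y \<cdot>\<^sub>m N" n] X N by auto
  qed
  define h where "h = det (map_mat (\<lambda>a. [:a:]) X + map_mat (\<lambda>m. [:0, m:]) N)"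
  have h: "poly h x = det (X + x \<cdot>\<^sub>m N)" for x
    unfolding h_def by (rule det_add_smult_poly[OF X N])
  have "constant (poly h)"
  proof (rule ccontr)
    assume "\<not> constant (poly h)"
    then obtain z where "poly h z = 0" using fundamental_theorem_of_algebra by blast
    then have "poly h y = 0" for y using vanish[of z y] by (simp add: h)
    then show False using \<open>\<not> constant (poly h)\<close> unfolding constant_def by metis
  qed
  then have "poly h x = poly h 0" unfolding constant_def by blast
  moreover have "X + 0 \<cdot>\<^sub>m N = X" using X N by (auto intro!: eq_matI)
  ultimately show ?thesis by (simp add: h)
qed

section \<open>Comparison of \<open>bar A\<close> with a polynomial in \<open>A\<close>\<close>

lemma mat_poly_commute_mat:
  assumes A: "A \<in> carrier_mat n n" and B: "B \<in> carrier_mat n n" and BA: "B * A = A * B"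
  shows "B * mat_poly cs A = mat_poly cs A * B"
proof (induction cs)
  case Nil
  then show ?case using B by (simp add: mat_poly_simps[OF A])
next
  case (Cons c cs)
  let ?H = "mat_poly cs A"
  have H: "?H \<in> carrier_mat n n" by (rule mat_poly_carrier[OF A])
  have "B * (A * ?H) = A * B * ?H"
    using assoc_mult_mat[OF B A H] BA by simp
  also have "\<dots> = A * (?H * B)"
    using assoc_mult_mat[OF A B H] Cons by simp
  also have "\<dots> = A * ?H * B"
    using assoc_mult_mat[OF A H B] by simp
  finally show ?case
    using A B H by (simp add: mat_poly_simps[OF A] add_mult_distrib_mat[where nr = n and n = n and nc = n]
        mult_add_distrib_mat[where nr = n and n = n and nc = n]
        mult_smult_distrib[where nr = n and n = n and nc = n]
        mult_smult_assoc_mat[where nr = n and n = n and nc = n])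
qed

lemma mat_poly_upper_triangular:
  assumes U: "U \<in> carrier_mat n n" and ut: "upper_triangular U"
  shows "upper_triangular (mat_poly cs U) \<and> (\<forall>i<n. mat_poly cs U $$ (i, i) = poly (Poly cs) (U $$ (i, i)))"
proof (induction cs)
  case Nil
  then show ?case using U by (simp add: mat_poly_simps[OF U])
next
  case (Cons c cs)
  let ?H = "mat_poly cs U"
  have H: "?H \<in> carrier_mat n n" by (rule mat_poly_carrier[OF U])
  \<comment> \<open>On or below the diagonal of the product only the term with
    \<open>i = j = k\<close> survives: otherwise \<open>k < i\<close> or \<open>j < k\<close>, and
    one factor lies strictly below its diagonal.\<close>
  have zero: "U $$ (i, k) * ?H $$ (k, j) = 0" if h: "i < n" "k < n" "j < i \<or> (i = j \<and> k \<noteq> i)" for i j k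
  proof -
    consider "k < i" | "j < k" using h by linarith
    then show ?thesis
    proof cases
      case 1
      then have "U $$ (i, k) = 0" using upper_triangularD[OF ut 1] U h by simp
      then show ?thesis by simp
    next
      case 2
      then have "?H $$ (k, j) = 0" using upper_triangularD[OF conjunct1[OF Cons] 2] H h by simp
      then show ?thesis by simp
    qed
  qed
  have entry: "(U * ?H) $$ (i, j) = (\<Sum>k<n. U $$ (i, k) * ?H $$ (k, j))" if "i < n" "j < n" for i j
    using U H that by (simp add: scalar_prod_def atLeast0LessThan)
  have lower: "(U * ?H) $$ (i, j) = 0" if "i < n" "j < i" for i j
  proof -
    have "j < n" using that by simp
    show ?thesis unfolding entry[OF that(1) \<open>j < n\<close>]
      by (rule sum.neutral) (use zero that in blast)
  qed
  have diag: "(U * ?H) $$ (i, i) = U $$ (i, i) * ?H $$ (i, i)" if "i < n" for i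
  proof -
    have "(U * ?H) $$ (i, i) = (\<Sum>k<n. if k = i then U $$ (i, i) * ?H $$ (i, i) else 0)"
      unfolding entry[OF that that] by (rule sum.cong) (use zero that in auto)
    then show ?thesis using that by simp
  qed
  show ?case unfolding mat_poly_simps[OF U]
  proof (intro conjI allI impI upper_triangularI)
    fix i j assume "j < i" "i < dim_row (c \<cdot>\<^sub>m 1\<^sub>m n + U * ?H)"
    then show "(c \<cdot>\<^sub>m 1\<^sub>m n + U * ?H) $$ (i, j) = 0"
      using U H lower by (simp del: index_mult_mat(1))
  next
    fix i assume "i < n"
    then show "(c \<cdot>\<^sub>m 1\<^sub>m n + U * ?H) $$ (i, i) = poly (Poly (c # cs)) (U $$ (i, i))"
      using U H diag Cons by (simp del: index_mult_mat(1))
  qed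
qed

text \<open>The difference commutes with \<open>A\<close>, so for each of its eigenvalues it has an
  eigenvector that is also one of \<open>A\<close>. On that vector \<open>bar A\<close> and the
  interpolating polynomial both act as the conjugate of the eigenvalue of \<open>A\<close>, so the
  difference kills it.\<close>

lemma eigenvalue_eigen_conjugation_minus_poly:
  assumes A: "A \<in> carrier_mat n n" and bar: "eigen_conjugation A bar"
    and f: "\<And>l. eigenvalue A l \<Longrightarrow> poly f l = cnj l"
    and N: "eigenvalue (bar A - mat_poly (coeffs f) A) l"
  shows "l = 0"
proof -
  define F where "F = mat_poly (coeffs f) A"
  define B where "B = bar A"
  have dim: "dim_row A = n" using A by simp
  have F: "F \<in> carrier_mat n n" and FA: "F * A = A * F"
    unfolding F_def using mat_poly_carrier[OF A] mat_poly_commute[OF A] by auto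
  have B: "B \<in> carrier_mat n n" and BA: "B * A = A * B"
    and Bu: "\<And>u l. u \<in> carrier_vec n \<Longrightarrow> A *\<^sub>v u = l \<cdot>\<^sub>v u \<Longrightarrow> B *\<^sub>v u = cnj l \<cdot>\<^sub>v u"
    using bar unfolding eigen_conjugation_def Let_def dim B_def by auto
  have NC: "B - F \<in> carrier_mat n n" using B F by (simp add: minus_carrier_mat)
  define M where "M = B - F - l \<cdot>\<^sub>m 1\<^sub>m n"
  have M: "M \<in> carrier_mat n n" using NC by (simp add: M_def minus_carrier_mat)
  have "M = char_matrix (B - F) l"
    using NC by (intro eq_matI) (auto simp: M_def char_matrix_def)
  then have "det M = 0"
    using N eigenvalue_det[OF NC, of l] by (simp add: F_def B_def)
  moreover have "M * A = A * M"
    using A B F BA FA unfolding M_def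
    by (simp add: minus_mult_distrib_mat[where nr = n and n = n and nc = n]
        mult_minus_distrib_mat[where nr = n and n = n and nc = n] minus_carrier_mat
        mult_smult_distrib[where nr = n and n = n and nc = n]
        mult_smult_assoc_mat[where nr = n and n = n and nc = n])
  ultimately obtain u a where u: "u \<in> carrier_vec n" "u \<noteq> 0\<^sub>v n" "M *\<^sub>v u = 0\<^sub>v n" "A *\<^sub>v u = a \<cdot>\<^sub>v u"
    using commuting_common_eigenvector[OF M A] by metis
  have "eigenvalue A a" using u A by (auto simp: eigenvalue_def eigenvector_def)
  then have "F *\<^sub>v u = cnj a \<cdot>\<^sub>v u"
    using mat_poly_eigenvector[OF A u(1,4), of "coeffs f"] f by (simp add: F_def)
  then have "M *\<^sub>v u = (cnj a \<cdot>\<^sub>v u - cnj a \<cdot>\<^sub>v u) - l \<cdot>\<^sub>v u"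
    using B F Bu[OF u(1,4)] u(1) unfolding M_def
    by (simp add: minus_mult_distrib_mat_vec[where nr = n and nc = n] minus_carrier_mat smult_mat_mult_vec[of _ n n])
  then have zero: "0\<^sub>v n = (cnj a \<cdot>\<^sub>v u - cnj a \<cdot>\<^sub>v u) - l \<cdot>\<^sub>v u" using u(3) by simp
  have lu: "l * u $ i = 0" if "i < n" for i
    using arg_cong[OF zero, of "\<lambda>v. v $ i"] u(1) that by simp
  have "\<exists>i<n. u $ i \<noteq> 0"
  proof (rule ccontr)
    assume "\<not> (\<exists>i<n. u $ i \<noteq> 0)"
    then have "u = 0\<^sub>v n" using u(1) by (intro eq_vecI) auto
    then show False using u(2) by simp
  qed
  then show ?thesis using lu by (metis mult_eq_0_iff)
qed

text \<open>Replacing \<open>bar A\<close> by an interpolating polynomial in \<open>A\<close>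
  changes the pencil by a commuting quasinilpotent term, hence not its determinant. A Schur basis of
  \<open>A\<close> then makes the whole pencil triangular, and \<open>es\<close> is the diagonal of
  the Schur form. Only the shape of the factors is used later, for the conjugation symmetry.\<close>

lemma det_pencil_eigen_conjugation:
  assumes A: "A \<in> carrier_mat n n" and bar: "eigen_conjugation A bar"
  shows "\<exists>es. \<forall>p s t. det (p \<cdot>\<^sub>m 1\<^sub>m n + s \<cdot>\<^sub>m A + t \<cdot>\<^sub>m bar A) = (\<Prod>e\<leftarrow>es. p + s * e + t * cnj e)"
proof -
  have "char_poly A \<noteq> 0" using degree_monic_char_poly[OF A] by auto
  then have "finite {l. poly (char_poly A) l = 0}" by (rule poly_roots_finite)
  from ex_poly_cnj[OF this] obtain f where f: "\<And>l. eigenvalue A l \<Longrightarrow> poly f l = cnj l"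
    using eigenvalue_root_char_poly[OF A] by auto
  define F where "F = mat_poly (coeffs f) A"
  define B where "B = bar A"
  have dim: "dim_row A = n" using A by simp
  have F: "F \<in> carrier_mat n n" and FA: "F * A = A * F"
    unfolding F_def using mat_poly_carrier[OF A] mat_poly_commute[OF A] by auto
  have B: "B \<in> carrier_mat n n" and BA: "B * A = A * B"
    using bar unfolding eigen_conjugation_def Let_def dim B_def by auto
  obtain U P Q where wit: "similar_mat_wit A U P Q" and ut: "upper_triangular U"
    using ex_schur[OF A] .
  note w = similar_mat_witD2[OF A wit]
  have U: "U \<in> carrier_mat n n" and P: "P \<in> carrier_mat n n" and Q: "Q \<in> carrier_mat n n"
    and PQ: "P * Q = 1\<^sub>m n" and QP: "Q * P = 1\<^sub>m n" and AU: "A = P * U * Q"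
    using w by auto
  define G where "G = mat_poly (coeffs f) U"
  have G: "G \<in> carrier_mat n n" unfolding G_def by (rule mat_poly_carrier[OF U])
  have FG: "F = P * G * Q" unfolding F_def G_def AU by (rule mat_poly_similar[OF U Q P QP PQ])
  have eU: "eigenvalue A (U $$ (i, i))" if "i < n" for i
  proof -
    have "char_poly A = char_poly U" using wit by (intro char_poly_similar) (auto simp: similar_mat_def)
    also have "\<dots> = (\<Prod>a\<leftarrow>diag_mat U. [:- a, 1:])" by (rule char_poly_upper_triangular[OF U ut])
    finally have "poly (char_poly A) (U $$ (i, i)) = 0"
      using that U by (auto simp: poly_prod_list o_def prod_list_zero_iff diag_mat_def)
    then show ?thesis using eigenvalue_root_char_poly[OF A] by simp
  qed
  have "det (p \<cdot>\<^sub>m 1\<^sub>m n + s \<cdot>\<^sub>m A + t \<cdot>\<^sub>m B) = (\<Prod>e\<leftarrow>diag_mat U. p + s * e + t * cnj e)" for p s t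
  proof -
    define X where "X = p \<cdot>\<^sub>m 1\<^sub>m n + s \<cdot>\<^sub>m A + t \<cdot>\<^sub>m F"
    define N where "N = B - F"
    define T where "T = p \<cdot>\<^sub>m 1\<^sub>m n + s \<cdot>\<^sub>m U + t \<cdot>\<^sub>m G"
    have X: "X \<in> carrier_mat n n" and N: "N \<in> carrier_mat n n" and T: "T \<in> carrier_mat n n"
      using A F B G U by (auto simp: X_def N_def T_def)
    have "p \<cdot>\<^sub>m 1\<^sub>m n + s \<cdot>\<^sub>m A + t \<cdot>\<^sub>m B = X + t \<cdot>\<^sub>m N"
      using A B F by (intro eq_matI) (auto simp: X_def N_def algebra_simps)
    moreover have "det (X + t \<cdot>\<^sub>m N) = det X"
    proof (rule det_add_smult_quasinilpotent[OF X N])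
      show "l = 0" if "eigenvalue N l" for l
        using eigenvalue_eigen_conjugation_minus_poly[OF A bar f] that by (simp add: N_def B_def F_def)
      have BF: "B * F = F * B" unfolding F_def by (rule mat_poly_commute_mat[OF A B BA])
      have comm: "X * Y = Y * X" if Y: "Y \<in> carrier_mat n n" and "Y * A = A * Y" "Y * F = F * Y" for Y
        using A F Y that(2,3) unfolding X_def
        by (simp add: mult_add_distrib_mat[where nr = n and n = n and nc = n]
            add_mult_distrib_mat[where nr = n and n = n and nc = n]
            mult_smult_distrib[where nr = n and n = n and nc = n]
            mult_smult_assoc_mat[where nr = n and n = n and nc = n])
      show "X * N = N * X"
        using comm[OF B BA BF] comm[OF F FA refl] X B F unfolding N_def
        by (simp add: minus_mult_distrib_mat[where nr = n and n = n and nc = n]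
            mult_minus_distrib_mat[where nr = n and n = n and nc = n])
    qed
    moreover have "det X = det T"
    proof (rule det_similar)
      have "X = P * T * Q"
        using P Q U G PQ assoc_mult_mat[OF P U Q] assoc_mult_mat[OF P G Q] unfolding X_def T_def AU FG
        by (simp add: mult_add_distrib_mat[where nr = n and n = n and nc = n]
            add_mult_distrib_mat[where nr = n and n = n and nc = n]
            mult_smult_distrib[where nr = n and n = n and nc = n]
            mult_smult_assoc_mat[where nr = n and n = n and nc = n])
      then show "similar_mat X T"
        unfolding similar_mat_def using similar_mat_witI[OF PQ QP _ X T P Q] by blast
    qed
    moreover have "det T = (\<Prod>e\<leftarrow>diag_mat U. p + s * e + t * cnj e)"
    proof -
      note mp = mat_poly_upper_triangular[OF U ut, of "coeffs f", folded G_def]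
      have "upper_triangular T"
        using mp ut U G by (auto simp: T_def upper_triangular_def)
      then have "det T = prod_list (diag_mat T)" using T by (rule det_upper_triangular)
      also have "diag_mat T = map (\<lambda>e. p + s * e + t * cnj e) (diag_mat U)"
        using U G mp f eU by (auto simp: diag_mat_def T_def)
      finally show ?thesis .
    qed
    ultimately show ?thesis by simp
  qed
  then show ?thesis unfolding B_def by blast
qed

section \<open>Comparison of the two pencils\<close>

text \<open>The device for comparing coefficients: identities valid for all values are brought to
  this shape, with explicit zeros for absent powers.\<close>

lemma quartic_eq_0_iff:
  fixes c0 c1 c2 c3 c4 :: complex
  assumes "\<And>x. c0 + c1 * x + c2 * x^2 + c3 * x^3 + c4 * x^4 = 0"
  shows "c0 = 0 \<and> c1 = 0 \<and> c2 = 0 \<and> c3 = 0 \<and> c4 = 0"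
proof -
  have "poly [:c0, c1, c2, c3, c4:] x = 0" for x
    using assms[of x] by (simp add: algebra_simps power2_eq_square power3_eq_cube power4_eq_xxxx)
  then have "[:c0, c1, c2, c3, c4:] = 0" using poly_all_0_iff_0 by blast
  then show ?thesis by simp
qed

text \<open>Both sides are the coefficient of \<open>x^2\<close> in the characteristic polynomial,
  read off once from its linear factors and once from \<open>det_pencil_single\<close> at
  \<open>s = - 1\<close>. The chosen eigenvalue list is a genuine one because complex polynomials
  split.\<close>

lemma e2_eq_minor_sum2:
  assumes M: "M \<in> carrier_mat 4 4"
  shows "e2 M = minor_sum2 M"
proof -
  have cp: "char_poly M = (\<Prod>e\<leftarrow>eigenvalue_list M. [:- e, 1:])"
    unfolding eigenvalue_list_def
    by (rule someI_ex) (use char_poly_factorized[OF M] in blast)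
  then have "length (eigenvalue_list M) = 4"
    using degree_monic_char_poly[OF M] degree_linear_factors[of uminus "eigenvalue_list M"] by simp
  then obtain a b c d where es: "eigenvalue_list M = [a, b, c, d]"
    by (auto simp: numeral_eq_Suc length_Suc_conv)
  have char: "poly (char_poly M) x = det (x \<cdot>\<^sub>m 1\<^sub>m 4 + (- 1) \<cdot>\<^sub>m M)" for x
    unfolding char_poly_def
    by (rule poly_det_cong[where n = 4]) (use M in \<open>auto simp: char_poly_matrix_def\<close>)
  have main: "(x - a) * (x - b) * (x - c) * (x - d)
      = x^4 - x^3 * mat_trace M + x^2 * minor_sum2 M - x * mat_trace (adj_mat M) + det M" for x
    using char[of x] by (simp add: det_pencil_single[OF M] cp es algebra_simps)
  have "(a * b * c * d - det M) + (mat_trace (adj_mat M) - (a*b*c + a*b*d + a*c*d + b*c*d)) * x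
    + (a*b + a*c + a*d + b*c + b*d + c*d - minor_sum2 M) * x^2
    + (mat_trace M - (a + b + c + d)) * x^3 + 0 * x^4 = 0" for x
    using main[of x] by (simp add: algebra_simps power2_eq_square power3_eq_cube power4_eq_xxxx)
  from quartic_eq_0_iff[OF this]
  have "minor_sum2 M = a*b + a*c + a*d + b*c + b*d + c*d" by simp
  then show ?thesis by (simp add: e2_def es Let_def numeral_eq_Suc algebra_simps)
qed

section \<open>The conic coefficients without inverses\<close>

lemma adj_mat_eq_smult_mat_inv:
  assumes A: "A \<in> carrier_mat n n" and inv: "invertible_mat A"
  shows "adj_mat A = det A \<cdot>\<^sub>m mat_inv A"
proof -
  note i = mat_inv[OF A inv] and adj = adj_mat[OF A]
  have "adj_mat A = adj_mat A * (A * mat_inv A)" using i adj by simp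
  also have "\<dots> = (adj_mat A * A) * mat_inv A" using assoc_mult_mat[OF adj(1) A i(1)] by simp
  also have "\<dots> = det A \<cdot>\<^sub>m (1\<^sub>m n * mat_inv A)"
    unfolding adj(3) using i by (intro mult_smult_assoc_mat) auto
  finally show ?thesis using i by simp
qed

lemma mat_trace_smult: "mat_trace (c \<cdot>\<^sub>m M) = c * mat_trace M" if "M \<in> carrier_mat n n"
  using that by (simp add: mat_trace_def sum_distrib_left)

lemma mat_trace_minus:
  "mat_trace (M - N) = mat_trace M - mat_trace N" if "M \<in> carrier_mat n n" "N \<in> carrier_mat n n"
  using that by (simp add: mat_trace_def sum_subtractf)

lemma mat_trace_mult_minus:
  assumes "X \<in> carrier_mat n n" "M \<in> carrier_mat n n" "N \<in> carrier_mat n n"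
  shows "mat_trace (X * (M - N)) = mat_trace (X * M) - mat_trace (X * N)"
  using assms by (simp add: mult_minus_distrib_mat[where nr = n and n = n and nc = n] mat_trace_minus[of _ n])

lemma mat_adjoint_carrier: "A \<in> carrier_mat n n \<Longrightarrow> mat_adjoint A \<in> carrier_mat n n"
  by (auto simp: mat_adjoint_def mat_of_rows_def)

lemma mat_adjoint_index:
  "A \<in> carrier_mat n n \<Longrightarrow> i < n \<Longrightarrow> j < n \<Longrightarrow> mat_adjoint A $$ (i, j) = cnj (A $$ (j, i))"
  by (auto simp: mat_adjoint_def mat_of_rows_def)

text \<open>For invertible \<open>A\<close> the adjugate is \<open>det A\<close> times the inverse,
  so both branches of the definition give one formula and later arguments need no case
  distinction.\<close>

lemma det_t_minus1_eq:
  assumes A: "A \<in> carrier_mat 4 4" and B: "B \<in> carrier_mat 4 4"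
  shows "det_t_minus1 A B = mat_trace (adj_mat A * mat_adjoint A) - mat_trace (adj_mat A * B)"
proof -
  have A': "mat_adjoint A \<in> carrier_mat 4 4" using A by (rule mat_adjoint_carrier)
  have D: "mat_adjoint A - B \<in> carrier_mat 4 4" using A' B by (simp add: minus_carrier_mat)
  have "det_t_minus1 A B = mat_trace (adj_mat A * (mat_adjoint A - B))"
  proof (cases "invertible_mat A")
    case True
    have i: "mat_inv A \<in> carrier_mat 4 4" using mat_inv[OF A True] by simp
    have "mat_zpow A (-1) = mat_inv A" using i by (simp add: mat_zpow_def)
    then have "det_t_minus1 A B = mat_trace (det A \<cdot>\<^sub>m (mat_inv A * (mat_adjoint A - B)))"
      using True i D by (simp add: det_t_minus1_def t_coeff_def mat_trace_smult[of _ 4])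
    also have "det A \<cdot>\<^sub>m (mat_inv A * (mat_adjoint A - B)) = adj_mat A * (mat_adjoint A - B)"
      unfolding adj_mat_eq_smult_mat_inv[OF A True] using mult_smult_assoc_mat[OF i D] by simp
    finally show ?thesis .
  qed (simp add: det_t_minus1_def)
  then show ?thesis using mat_trace_mult_minus[OF adj_mat(1)[OF A] A' B] by simp
qed

lemma det_add_smult:
  assumes A: "A \<in> carrier_mat 4 4" and B: "B \<in> carrier_mat 4 4"
  shows "det (A + t \<cdot>\<^sub>m B) = det A + mat_trace (adj_mat A * B) * t + mixed_det A B * t^2
    + mat_trace (adj_mat B * A) * t^3 + det B * t^4"
proof -
  have "A + t \<cdot>\<^sub>m B = 0 \<cdot>\<^sub>m 1\<^sub>m 4 + 1 \<cdot>\<^sub>m A + t \<cdot>\<^sub>m B"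
    using A B by (intro eq_matI) auto
  then show ?thesis
    by (simp add: det_pencil[OF A B] det_pencil_single[OF A] det_pencil_single[OF B]
        algebra_simps power2_eq_square power3_eq_cube power4_eq_xxxx)
qed

text \<open>Both branches are the coefficient of \<open>t^2\<close> in
  \<open>det (A + t \<cdot>\<^sub>m M)\<close>. In the invertible case this follows by taking out
  the factor \<open>det A\<close>, which leaves the pencil of the identity and
  \<open>mat_inv A * M\<close>.\<close>

lemma det_e2_eq_mixed_det:
  assumes A: "A \<in> carrier_mat 4 4" and M: "M \<in> carrier_mat 4 4"
  shows "det_e2 A M = mixed_det A M"
proof (cases "invertible_mat A")
  case True
  note i = mat_inv[OF A True]
  define N where "N = mat_inv A * M"
  have N: "N \<in> carrier_mat 4 4" using i M by (simp add: N_def)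
  have AN: "A * N = M" using assoc_mult_mat[OF A i(1) M] i(2) M by (simp add: N_def)
  have main: "det A * (1 + t * mat_trace N + t^2 * minor_sum2 N + t^3 * mat_trace (adj_mat N) + t^4 * det N)
    = det A + mat_trace (adj_mat A * M) * t + mixed_det A M * t^2
    + mat_trace (adj_mat M * A) * t^3 + det M * t^4" for t
  proof -
    have "1 \<cdot>\<^sub>m A = A" by (intro eq_matI) auto
    then have "det (A + t \<cdot>\<^sub>m M) = det (A * (1 \<cdot>\<^sub>m 1\<^sub>m 4 + t \<cdot>\<^sub>m N))"
      using A N AN by (simp add: mult_add_distrib_mat[where nr = 4 and n = 4 and nc = 4]
          mult_smult_distrib[where nr = 4 and n = 4 and nc = 4])
    also have "\<dots> = det A * det (1 \<cdot>\<^sub>m 1\<^sub>m 4 + t \<cdot>\<^sub>m N)"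
      using A N by (intro det_mult) auto
    finally show ?thesis by (simp add: det_add_smult[OF A M] det_pencil_single[OF N])
  qed
  have "0 + (det A * mat_trace N - mat_trace (adj_mat A * M)) * t
    + (det A * minor_sum2 N - mixed_det A M) * t^2
    + (det A * mat_trace (adj_mat N) - mat_trace (adj_mat M * A)) * t^3
    + (det A * det N - det M) * t^4 = 0" for t
    using main[of t] by (simp add: algebra_simps)
  from quartic_eq_0_iff[OF this] have "det A * minor_sum2 N = mixed_det A M" by simp
  then show ?thesis
    using True e2_eq_minor_sum2[OF N] by (simp add: det_e2_def N_def)
next
  case False
  define h where "h = det (map_mat (\<lambda>a. [:a:]) A + map_mat (\<lambda>m. [:0, m:]) M)"
  have "poly h t = poly [:det A, mat_trace (adj_mat A * M), mixed_det A M,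
      mat_trace (adj_mat M * A), det M:] t" for t
    unfolding h_def det_add_smult_poly[OF A M] det_add_smult[OF A M]
    by (simp add: algebra_simps power2_eq_square power3_eq_cube power4_eq_xxxx)
  then have "h = [:det A, mat_trace (adj_mat A * M), mixed_det A M, mat_trace (adj_mat M * A), det M:]"
    by (intro poly_eq_poly_eq_iff[THEN iffD1] ext)
  then show ?thesis using False by (simp add: det_e2_def h_def[symmetric] numeral_2_eq_2)
qed

section \<open>Conjugation symmetry of the pencils\<close>

lemma det_mat_adjoint:
  assumes A: "A \<in> carrier_mat n n"
  shows "det (mat_adjoint A) = cnj (det A)"
proof -
  interpret cnj: comm_ring_hom cnj by unfold_locales auto
  have "mat_adjoint A = (map_mat cnj A)\<^sup>T"
    using A mat_adjoint_carrier[OF A] by (intro eq_matI) (auto simp: mat_adjoint_index)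
  then show ?thesis using det_transpose[of "map_mat cnj A" n] A by simp
qed

text \<open>The property shared by \<open>mat_adjoint A\<close> and \<open>bar A\<close>:
  conjugation exchanges the roles of \<open>s\<close> and \<open>t\<close>. It allows the
  coefficients of both pencils to be treated at once, although \<open>bar A\<close> need not be the
  adjoint.\<close>

definition pencil_symmetric :: "complex mat \<Rightarrow> complex mat \<Rightarrow> bool" where
  "pencil_symmetric A B \<longleftrightarrow> (\<forall>p s t.
     cnj (det (p \<cdot>\<^sub>m 1\<^sub>m (dim_row A) + s \<cdot>\<^sub>m A + t \<cdot>\<^sub>m B))
       = det (cnj p \<cdot>\<^sub>m 1\<^sub>m (dim_row A) + cnj t \<cdot>\<^sub>m A + cnj s \<cdot>\<^sub>m B))"

lemma pencil_symmetric_adjoint: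
  assumes A: "A \<in> carrier_mat n n"
  shows "pencil_symmetric A (mat_adjoint A)"
  unfolding pencil_symmetric_def carrier_matD(1)[OF A]
proof (intro allI)
  fix p s t
  let ?X = "p \<cdot>\<^sub>m 1\<^sub>m n + s \<cdot>\<^sub>m A + t \<cdot>\<^sub>m mat_adjoint A"
  note A' = mat_adjoint_carrier[OF A]
  have X: "?X \<in> carrier_mat n n" using A A' by auto
  have "mat_adjoint ?X = cnj p \<cdot>\<^sub>m 1\<^sub>m n + cnj t \<cdot>\<^sub>m A + cnj s \<cdot>\<^sub>m mat_adjoint A"
    using A A' mat_adjoint_carrier[OF X]
    by (intro eq_matI) (auto simp: mat_adjoint_index[OF X] mat_adjoint_index[OF A])
  then show "cnj (det ?X) = det (cnj p \<cdot>\<^sub>m 1\<^sub>m n + cnj t \<cdot>\<^sub>m A + cnj s \<cdot>\<^sub>m mat_adjoint A)"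
    using det_mat_adjoint[OF X] by simp
qed

text \<open>Each linear factor of the determinant has the symmetry, hence so does their
  product.\<close>

lemma pencil_symmetric_eigen_conjugation:
  assumes A: "A \<in> carrier_mat n n" and bar: "eigen_conjugation A bar"
  shows "pencil_symmetric A (bar A)"
proof -
  obtain es where es:
    "\<And>p s t. det (p \<cdot>\<^sub>m 1\<^sub>m n + s \<cdot>\<^sub>m A + t \<cdot>\<^sub>m bar A) = (\<Prod>e\<leftarrow>es. p + s * e + t * cnj e)"
    using det_pencil_eigen_conjugation[OF assms] by blast
  have "cnj (\<Prod>e\<leftarrow>es. f e) = (\<Prod>e\<leftarrow>es. cnj (f e))" for f
    by (induction es) auto
  then show ?thesis using A by (simp add: pencil_symmetric_def es add_ac)
qed

lemma pencil_symmetricD: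
  assumes A: "A \<in> carrier_mat n n" and sym: "pencil_symmetric A B"
  shows "cnj (det (cnj p \<cdot>\<^sub>m 1\<^sub>m n + cnj s \<cdot>\<^sub>m A + cnj t \<cdot>\<^sub>m B))
    = det (p \<cdot>\<^sub>m 1\<^sub>m n + t \<cdot>\<^sub>m A + s \<cdot>\<^sub>m B)"
  using sym A unfolding pencil_symmetric_def by (metis carrier_matD(1) complex_cnj_cnj)

text \<open>The case of a zero coefficient in the symmetry. The part of the pencil without
  \<open>A\<close> is thus determined by \<open>A\<close> alone, so it is the same for the adjoint
  and for \<open>bar A\<close>.\<close>

lemma pencil_symmetric_det_single:
  assumes A: "A \<in> carrier_mat n n" and B: "B \<in> carrier_mat n n" and sym: "pencil_symmetric A B"
  shows "det (p \<cdot>\<^sub>m 1\<^sub>m n + t \<cdot>\<^sub>m B) = cnj (det (cnj p \<cdot>\<^sub>m 1\<^sub>m n + cnj t \<cdot>\<^sub>m A))"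
proof -
  have "p \<cdot>\<^sub>m 1\<^sub>m n + t \<cdot>\<^sub>m B = p \<cdot>\<^sub>m 1\<^sub>m n + 0 \<cdot>\<^sub>m A + t \<cdot>\<^sub>m B"
    using A B by (intro eq_matI) auto
  moreover have "cnj p \<cdot>\<^sub>m 1\<^sub>m n + cnj t \<cdot>\<^sub>m A = cnj p \<cdot>\<^sub>m 1\<^sub>m n + cnj t \<cdot>\<^sub>m A + cnj 0 \<cdot>\<^sub>m B"
    using A B by (intro eq_matI) auto
  ultimately show ?thesis using pencil_symmetricD[OF A sym, of p t 0] by simp
qed

lemma pencil_symmetric_mat_trace:
  assumes A: "A \<in> carrier_mat 4 4" and B: "B \<in> carrier_mat 4 4" and sym: "pencil_symmetric A B"
  shows "mat_trace B = cnj (mat_trace A)"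
proof -
  have main: "det (1 \<cdot>\<^sub>m 1\<^sub>m 4 + t \<cdot>\<^sub>m B) = cnj (det (cnj 1 \<cdot>\<^sub>m 1\<^sub>m 4 + cnj t \<cdot>\<^sub>m A))" for t
    by (rule pencil_symmetric_det_single[OF A B sym])
  have "0 + (mat_trace B - cnj (mat_trace A)) * t + (minor_sum2 B - cnj (minor_sum2 A)) * t^2
    + (mat_trace (adj_mat B) - cnj (mat_trace (adj_mat A))) * t^3 + (det B - cnj (det A)) * t^4 = 0" for t
    using main[of t] by (simp add: det_pencil_single[OF A] det_pencil_single[OF B] algebra_simps)
  from quartic_eq_0_iff[OF this] show ?thesis by simp
qed

text \<open>The coefficient of \<open>p s\<^sup>2 t\<close> in \<open>det (p I + s A + t B)\<close>.\<close>

definition cubic_coeff :: "complex mat \<Rightarrow> complex mat \<Rightarrow> complex" where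
  "cubic_coeff A B = mat_trace (A * A * B) - mat_trace A * mat_trace (A * B) + minor_sum2 A * mat_trace B"

text \<open>Subtracting the mirrored conjugate expansion removes the single pencils. What remains is
  \<open>s * t\<close> times a quadratic form that pairs each coefficient with the conjugate of its
  mirror image.\<close>

lemma pencil_symmetric_coeffs:
  assumes A: "A \<in> carrier_mat 4 4" and B: "B \<in> carrier_mat 4 4" and sym: "pencil_symmetric A B"
  shows "cnj (mat_trace A * mat_trace B - mat_trace (A * B)) = mat_trace A * mat_trace B - mat_trace (A * B)"
    and "cubic_coeff B A = cnj (cubic_coeff A B)"
    and "mat_trace (adj_mat B * A) = cnj (mat_trace (adj_mat A * B))"
proof -
  define c where "c = mat_trace A * mat_trace B - mat_trace (A * B)"
  define k k' where "k = cubic_coeff A B" and "k' = cubic_coeff B A"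
  define d d' w where "d = mat_trace (adj_mat A * B)" and "d' = mat_trace (adj_mat B * A)"
    and "w = mixed_det A B"
  have tr: "mat_trace (B * A) = mat_trace (A * B)"
    using A B by (simp add: mat_trace_mult[of _ 4] sum_lessThan_4 mult.commute)
  have Q: "det (p \<cdot>\<^sub>m 1\<^sub>m 4 + s \<cdot>\<^sub>m A + t \<cdot>\<^sub>m B)
    = det (p \<cdot>\<^sub>m 1\<^sub>m 4 + s \<cdot>\<^sub>m A) + det (p \<cdot>\<^sub>m 1\<^sub>m 4 + t \<cdot>\<^sub>m B) - p^4
     + s * t * (c * p^2 + k * p * s + k' * p * t + d * s^2 + w * s * t + d' * t^2)" for p s t
    unfolding det_pencil[OF A B] c_def k_def k'_def d_def d'_def w_def cubic_coeff_def tr ..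
  have diff: "s * t * ((cnj c - c) * p^2 + (cnj k - k') * p * s + (cnj k' - k) * p * t
      + (cnj d - d') * s^2 + (cnj w - w) * s * t + (cnj d' - d) * t^2) = 0" for p s t
  proof -
    have "cnj (det (cnj p \<cdot>\<^sub>m 1\<^sub>m 4 + cnj s \<cdot>\<^sub>m A)) = det (p \<cdot>\<^sub>m 1\<^sub>m 4 + s \<cdot>\<^sub>m B)"
      using pencil_symmetric_det_single[OF A B sym, of p s] by simp
    moreover have "cnj (det (cnj p \<cdot>\<^sub>m 1\<^sub>m 4 + cnj t \<cdot>\<^sub>m B)) = det (p \<cdot>\<^sub>m 1\<^sub>m 4 + t \<cdot>\<^sub>m A)"
      using pencil_symmetric_det_single[OF A B sym, of "cnj p" "cnj t"] by simp
    ultimately show ?thesis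
      using pencil_symmetricD[OF A sym, of p s t] unfolding Q by (simp add: algebra_simps power2_eq_square)
  qed
  \<comment> \<open>Here \<open>s = 1\<close> and \<open>p = 0\<close>, which isolates the terms
    without \<open>p\<close>.\<close>
  have "0 + (cnj d - d') * t + (cnj w - w) * t^2 + (cnj d' - d) * t^3 + 0 * t^4 = 0" for t
    using diff[of 1 t 0] by (simp add: algebra_simps power2_eq_square power3_eq_cube)
  from quartic_eq_0_iff[OF this] have d: "d' = cnj d" and w: "cnj w = w" by auto
  \<comment> \<open>Here \<open>s = p = 1\<close>. The coefficient of \<open>t^2\<close> relates
    \<open>k\<close> and \<open>k'\<close>; with this the coefficient of \<open>t\<close> shows that
    \<open>c\<close> is real.\<close>
  have "0 + ((cnj c - c) + (cnj k - k')) * t + (cnj k' - k) * t^2 + 0 * t^3 + 0 * t^4 = 0" for t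
    using diff[of 1 t 1] by (simp add: d w algebra_simps power2_eq_square)
  from quartic_eq_0_iff[OF this] have k: "cnj k' = k" and ck: "(cnj c - c) + (cnj k - k') = 0" by auto
  have "k' = cnj k" using k by (metis complex_cnj_cnj)
  then show "cnj (mat_trace A * mat_trace B - mat_trace (A * B)) = mat_trace A * mat_trace B - mat_trace (A * B)"
    and "cubic_coeff B A = cnj (cubic_coeff A B)"
    and "mat_trace (adj_mat B * A) = cnj (mat_trace (adj_mat A * B))"
    using ck d unfolding c_def k_def k'_def d_def d'_def by simp_all
qed

section \<open>The difference of the two pencils\<close>

lemma t_coeff_1:
  assumes A: "A \<in> carrier_mat n n" and B: "B \<in> carrier_mat n n"
  shows "t_coeff 1 A B = mat_trace (A * mat_adjoint A) - mat_trace (A * B)"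
  using mat_trace_mult_minus[OF A mat_adjoint_carrier[OF A] B] A
  by (simp add: t_coeff_def mat_zpow_def)

lemma t_coeff_2:
  assumes A: "A \<in> carrier_mat n n" and B: "B \<in> carrier_mat n n"
  shows "t_coeff 2 A B = mat_trace (A * A * mat_adjoint A) - mat_trace (A * A * B)"
  using mat_trace_mult_minus[OF mult_carrier_mat[OF A A] mat_adjoint_carrier[OF A] B] A
  by (simp add: t_coeff_def mat_zpow_def numeral_2_eq_2)

lemma det_adjoint_pencil_minus_det_bar_pencil:
  assumes A: "A \<in> carrier_mat 4 4" and bar: "eigen_conjugation A bar"
    and chi: "chi_pair A (bar A) x y"
  shows "det (p \<cdot>\<^sub>m 1\<^sub>m 4 + s \<cdot>\<^sub>m A + t \<cdot>\<^sub>m mat_adjoint A) - det (p \<cdot>\<^sub>m 1\<^sub>m 4 + s \<cdot>\<^sub>m A + t \<cdot>\<^sub>m bar A)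
    = s * t * (gamma2 A (bar A) x y * s * t
        - t_coeff 1 A (bar A) * (p + s * x + t * cnj x) * (p + s * y + t * cnj y))"
proof -
  define B A' where "B = bar A" and "A' = mat_adjoint A"
  have B: "B \<in> carrier_mat 4 4"
    using bar A by (auto simp: eigen_conjugation_def Let_def B_def)
  have A': "A' \<in> carrier_mat 4 4" unfolding A'_def by (rule mat_adjoint_carrier[OF A])
  have symB: "pencil_symmetric A B" unfolding B_def by (rule pencil_symmetric_eigen_conjugation[OF A bar])
  have symA': "pencil_symmetric A A'" unfolding A'_def by (rule pencil_symmetric_adjoint[OF A])
  note coB = pencil_symmetric_coeffs[OF A B symB] and coA' = pencil_symmetric_coeffs[OF A A' symA']
  \<comment> \<open>Up to the sign of \<open>t1\<close>, these are the coefficients of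
    \<open>p^2\<close>, \<open>p * s\<close>, \<open>s^2\<close> and \<open>s * t\<close> in the
    difference divided by \<open>s * t\<close>.\<close>
  define t1 k d g where "t1 = t_coeff 1 A B" and "k = t_coeff 2 A B - mat_trace A * t1"
    and "d = det_t_minus1 A B" and "g = det_e2 A A' - det_e2 A B"
  have tr: "mat_trace A' = mat_trace B"
    using pencil_symmetric_mat_trace[OF A B symB] pencil_symmetric_mat_trace[OF A A' symA'] by simp
  have single: "det (p \<cdot>\<^sub>m 1\<^sub>m 4 + t \<cdot>\<^sub>m A') = det (p \<cdot>\<^sub>m 1\<^sub>m 4 + t \<cdot>\<^sub>m B)"
    using pencil_symmetric_det_single[OF A B symB, of p t]
      pencil_symmetric_det_single[OF A A' symA', of p t] by simp
  have trBA: "mat_trace (M * A) = mat_trace (A * M)" if "M \<in> carrier_mat 4 4" for M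
    using A that by (simp add: mat_trace_mult[of _ 4] sum_lessThan_4 mult.commute)
  have Q: "det (p \<cdot>\<^sub>m 1\<^sub>m 4 + s \<cdot>\<^sub>m A + t \<cdot>\<^sub>m M)
    = det (p \<cdot>\<^sub>m 1\<^sub>m 4 + s \<cdot>\<^sub>m A) + det (p \<cdot>\<^sub>m 1\<^sub>m 4 + t \<cdot>\<^sub>m M) - p^4
     + s * t * ((mat_trace A * mat_trace M - mat_trace (A * M)) * p^2
       + cubic_coeff A M * p * s + cnj (cubic_coeff A M) * p * t
       + mat_trace (adj_mat A * M) * s^2 + det_e2 A M * s * t + cnj (mat_trace (adj_mat A * M)) * t^2)"
    if M: "M \<in> carrier_mat 4 4" and sym: "pencil_symmetric A M" for M
    unfolding det_pencil[OF A M] det_e2_eq_mixed_det[OF A M] pencil_symmetric_coeffs(3)[OF A M sym]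
      pencil_symmetric_coeffs(2)[OF A M sym, symmetric] by (simp add: cubic_coeff_def trBA[OF M])
  have t1: "t1 = mat_trace (A * A') - mat_trace (A * B)"
    unfolding t1_def A'_def by (rule t_coeff_1[OF A B])
  have k: "k = cubic_coeff A A' - cubic_coeff A B"
    unfolding k_def t1 t_coeff_2[OF A B] cubic_coeff_def tr by (simp add: A'_def algebra_simps)
  have d: "d = mat_trace (adj_mat A * A') - mat_trace (adj_mat A * B)"
    unfolding d_def A'_def by (rule det_t_minus1_eq[OF A B])
  have "t1 = (mat_trace A * mat_trace B - mat_trace (A * B)) - (mat_trace A * mat_trace A' - mat_trace (A * A'))"
    unfolding t1 tr by simp
  \<comment> \<open>Reality of \<open>t1\<close> makes \<open>cnj k\<close> and \<open>cnj d\<close>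
    the same symmetric functions of \<open>cnj x\<close> and \<open>cnj y\<close>, as the
    factorization requires.\<close>
  then have real: "cnj t1 = t1" using coB(1) coA'(1) by (metis complex_cnj_diff)
  have diff: "det (p \<cdot>\<^sub>m 1\<^sub>m 4 + s \<cdot>\<^sub>m A + t \<cdot>\<^sub>m A') - det (p \<cdot>\<^sub>m 1\<^sub>m 4 + s \<cdot>\<^sub>m A + t \<cdot>\<^sub>m B)
    = s * t * (- t1 * p^2 + k * p * s + cnj k * p * t + d * s^2 + g * s * t + cnj d * t^2)"
    unfolding Q[OF A' symA'] Q[OF B symB] single tr k d g_def t1 by (simp add: algebra_simps)
  have chi': "t1 * z^2 + k * z - d = t1 * (z - x) * (z - y)" for z
    using chi[unfolded chi_pair_def, rule_format, of z]
    unfolding B_def[symmetric] t1_def[symmetric] d_def[symmetric] k_def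
    by (simp add: algebra_simps)
  \<comment> \<open>Vieta's relations, obtained from the values at 0 and 1 without division by
    \<open>t1\<close>; the case \<open>t1 = 0\<close> is included.\<close>
  have d': "d = - t1 * x * y" using chi'[of 0] minus_equation_iff[of d] by simp
  have "k + t1 * (x + y) = 0" using chi'[of 1] by (simp add: d' algebra_simps)
  then have k': "k = - t1 * (x + y)" by (simp add: eq_neg_iff_add_eq_0)
  \<comment> \<open>The second summand cancels the \<open>s * t\<close> terms in the product of the
    two linear forms.\<close>
  have gam: "gamma2 A B x y = g + t1 * (x * cnj y + cnj x * y)"
    by (simp add: gamma2_def g_def t1_def A'_def)
  have "- t1 * p^2 + k * p * s + cnj k * p * t + d * s^2 + g * s * t + cnj d * t^2
    = gamma2 A B x y * s * t - t1 * (p + s * x + t * cnj x) * (p + s * y + t * cnj y)"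
    unfolding gam k' d' by (simp add: real algebra_simps power2_eq_square)
  then show ?thesis using diff unfolding B_def A'_def t1_def by simp
qed

theorem corollary64:
  fixes A :: "complex mat" and bar :: "complex mat \<Rightarrow> complex mat"
    and \<chi>\<^sub>1 \<chi>\<^sub>2 a z :: complex and \<theta> :: real
  assumes "A \<in> carrier_mat 4 4"
    and "eigen_conjugation A bar"
    and "chi_pair A (bar A) \<chi>\<^sub>1 \<chi>\<^sub>2"
    and "inner_conic_tangent A (bar A) \<chi>\<^sub>1 \<chi>\<^sub>2 (pedal z \<theta>) \<theta>"
    and "eigenvalue A a"
    and "a \<in> oriented_line z \<theta>"
  shows "kippenhahn_tangent A (pedal z \<theta>) \<theta>"
proof -
  note A = assms(1) and bar = assms(2)
  define p :: complex where "p = of_real (pedal z \<theta>)"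
  \<comment> \<open>With this \<open>s\<close>, twice the real part of \<open>s * w\<close> is
    \<open>cos \<theta> * Im w - sin \<theta> * Re w\<close>. Its modulus 1/2 accounts for the
    factor 4 in \<open>inner_conic_tangent\<close>.\<close>
  define s where "s = - \<i> * cis (- \<theta>) / 2"
  have st: "s * cnj s = 1 / 4"
    using sin_cos_squared_add[of \<theta>]
    by (simp add: s_def complex_eq_iff power2_eq_square field_simps)
  have pedal: "of_real (pedal_at (pedal z \<theta>) \<theta> w) = p + s * w + cnj s * cnj w" for w
    by (simp add: pedal_at_def p_def s_def complex_eq_iff field_simps)
  have Z: "bar A \<in> carrier_mat 4 4"
    using bar A by (auto simp: eigen_conjugation_def Let_def)
  have s: "s = of_real (cos \<theta>) * (1 / (2 * \<i>)) - of_real (sin \<theta>) * (1 / 2)"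
    "cnj s = - of_real (cos \<theta>) * (1 / (2 * \<i>)) - of_real (sin \<theta>) * (1 / 2)"
    by (simp_all add: s_def complex_eq_iff)
  have "pedal_mat (pedal z \<theta>) \<theta> A = p \<cdot>\<^sub>m 1\<^sub>m 4 + s \<cdot>\<^sub>m A + cnj s \<cdot>\<^sub>m mat_adjoint A"
  proof (rule eq_matI)
    fix i j assume "i < dim_row (p \<cdot>\<^sub>m 1\<^sub>m 4 + s \<cdot>\<^sub>m A + cnj s \<cdot>\<^sub>m mat_adjoint A)"
      "j < dim_col (p \<cdot>\<^sub>m 1\<^sub>m 4 + s \<cdot>\<^sub>m A + cnj s \<cdot>\<^sub>m mat_adjoint A)"
    then show "pedal_mat (pedal z \<theta>) \<theta> A $$ (i, j)
        = (p \<cdot>\<^sub>m 1\<^sub>m 4 + s \<cdot>\<^sub>m A + cnj s \<cdot>\<^sub>m mat_adjoint A) $$ (i, j)"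
      using A mat_adjoint_carrier[OF A]
      unfolding s by (simp add: pedal_mat_def Re_mat_def Im_mat_def p_def algebra_simps del: cis_cnj)
  qed (use A mat_adjoint_carrier[OF A] in \<open>auto simp: pedal_mat_def Re_mat_def Im_mat_def\<close>)
  moreover have "det (p \<cdot>\<^sub>m 1\<^sub>m 4 + s \<cdot>\<^sub>m A + cnj s \<cdot>\<^sub>m mat_adjoint A)
      = det (p \<cdot>\<^sub>m 1\<^sub>m 4 + s \<cdot>\<^sub>m A + cnj s \<cdot>\<^sub>m bar A)"
  proof -
    \<comment> \<open>Tangency to the conic says exactly that the bracket in the difference formula
      vanishes.\<close>
    have "t_coeff 1 A (bar A) * (p + s * \<chi>\<^sub>1 + cnj s * cnj \<chi>\<^sub>1) * (p + s * \<chi>\<^sub>2 + cnj s * cnj \<chi>\<^sub>2)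
        = gamma2 A (bar A) \<chi>\<^sub>1 \<chi>\<^sub>2 * (s * cnj s)"
      using assms(4) unfolding inner_conic_tangent_def pedal st by simp
    then show ?thesis
      using det_adjoint_pencil_minus_det_bar_pencil[OF A bar assms(3), of p s "cnj s"]
      by (simp add: mult.assoc)
  qed
  \<comment> \<open>An eigenvector of \<open>A\<close> for \<open>a\<close> is mapped by
    \<open>bar A\<close> to \<open>cnj a\<close> times itself. The pencil therefore multiplies it by
    the pedal value of \<open>a\<close>, which is 0 on a line through \<open>a\<close>.\<close>
  moreover have "det (p \<cdot>\<^sub>m 1\<^sub>m 4 + s \<cdot>\<^sub>m A + cnj s \<cdot>\<^sub>m bar A) = 0"
  proof -
    obtain u where u: "u \<in> carrier_vec 4" "u \<noteq> 0\<^sub>v 4" "A *\<^sub>v u = a \<cdot>\<^sub>v u"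
      using assms(5) A by (auto simp: eigenvalue_def eigenvector_def)
    have Bu: "bar A *\<^sub>v u = cnj a \<cdot>\<^sub>v u"
      using bar A u by (auto simp: eigen_conjugation_def Let_def)
    have pa: "p + s * a + cnj s * cnj a = 0"
      using assms(6) pedal[of a] by (simp add: in_oriented_line_iff)
    let ?X = "p \<cdot>\<^sub>m 1\<^sub>m 4 + s \<cdot>\<^sub>m A + cnj s \<cdot>\<^sub>m bar A"
    have X: "?X \<in> carrier_mat 4 4" using A Z by auto
    have "?X *\<^sub>v u = p \<cdot>\<^sub>v u + s \<cdot>\<^sub>v (a \<cdot>\<^sub>v u) + cnj s \<cdot>\<^sub>v (cnj a \<cdot>\<^sub>v u)"
      using A Z u(1) u(3) Bu
      by (simp add: add_mult_distrib_mat_vec[where nr = 4 and nc = 4] smult_mat_mult_vec[of _ 4 4])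
    also have "\<dots> = (p + s * a + cnj s * cnj a) \<cdot>\<^sub>v u"
      using u(1) by (intro eq_vecI) (auto simp: algebra_simps)
    also have "\<dots> = 0\<^sub>v 4" unfolding pa using u(1) by (intro eq_vecI) auto
    finally show ?thesis using u det_0_iff_vec_prod_zero[OF X] by blast
  qed
  ultimately show ?thesis by (simp add: kippenhahn_tangent_def)
qed

end
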